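(* Let $F\subset\mathbb{R}^n$ be non-empty and compact. Suppose that there exist $C\ge1$, $\eta_0\in(0,1)$, and a sequence $r_j\downarrow0$ such that $$\limsup_{j\to\infty}\frac{M_{r_j}(F\cap B)}{M_{r_j}(F)}\le\frac{C}{N(F;\delta)}$$ for every $\delta\in\Delta_n$ with $\delta_1<\eta_0$ and every open box $B\subset\mathbb{R}^n$ of arbitrary orientation whose ordered side lengths satisfy $l_i(B)\le\delta_i$ for $1\le i\le n$. Then $$\mathrm P_{\mathrm H}(F)=\underline{\mathrm P}(F).$$
   Context: An open box in $\mathbb{R}^n$ is an open rectangular box with positive side lengths and arbitrary orientation; its side lengths in decreasing order are $l_1(B)\ge\cdots\ge l_n(B)>0$. Let $\Delta_n=\{\delta\in(0,1)^n:\delta_1\ge\cdots\ge\delta_n\}$. For non-empty bounded $F\subset\mathbb{R}^n$ and $\delta\in\Delta_n$, $N(F;\delta)$ is the least number of open boxes $B$ needed to cover $F$, subject to $l_i(B)\le\delta_i$ for $1\le i\le n$ for every box in the cover (boxes may have different orientations). For bounded $E\subset\mathbb{R}^n$ and $r\in(0,1)$, $M_r(E)=N(E;(r,\ldots,r))$, with $M_r(\varnothing)=0$. For $\alpha\in[0,\infty)^n$ write $\delta^\alpha=\prod_i\delta_i^{\alpha_i}$. The lower box dimension print is $$\underline{\mathrm P}(F)=\Bigl\{\alpha\in[0,\infty)^n:\liminf_{\delta\in\Delta_n,\,\delta_1\downarrow0}N(F;\delta)\delta^\alpha>0\Bigr\},$$ the lower limit being over all of $\Delta_n$ as $\delta_1\downarrow0$.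 Hausdorff dimension print: for $\alpha\in[0,\infty)^n$ and a box $B$ put $r^\alpha(B)=\prod_{i=1}^n l_i(B)^{\alpha_i}$. For $\eta>0$ let $\mu^\alpha_\eta(E)=\inf\{\sum_jr^\alpha(B_j)\}$, the infimum over finite or countable covers of $E$ by open boxes $B_j$ with $\operatorname{diam}B_j\le\eta$, and $\mu^\alpha(E)=\lim_{\eta\downarrow0}\mu^\alpha_\eta(E)$. Then $\mathrm P_{\mathrm H}(E)=\{\alpha\in[0,\infty)^n:\mu^\alpha(E)>0\}$. *)

theory Defs
  imports "HOL-Analysis.Analysis"
begin

text \<open>
  Vectors of \<open>\<real>\<^sup>n\<close> are of type \<^typ>\<open>real^'n\<close> with a finite, linearly ordered index type, so that
  ``decreasing order'' of coordinates makes sense; the numeral types provide one for every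
  \<open>n \<ge> 1\<close>. The index 1 of the paper is the least element of the index type.
\<close>

definition first_coord :: "real^'n::{finite,linorder} \<Rightarrow> real" where
  "first_coord v = v $ Min UNIV"

definition decreasing_vec :: "real^'n::{finite,linorder} \<Rightarrow> bool" where
  "decreasing_vec v \<longleftrightarrow> (\<forall>i j. i \<le> j \<longrightarrow> v $ j \<le> v $ i)"

text \<open>
  \<open>open_box l B\<close>: the set \<open>B\<close> is an open box of arbitrary position and orientation, and its
  side lengths in decreasing order are \<open>l\<^sub>1 \<ge> \<dots> \<ge> l\<^sub>n > 0\<close>. Side lengths are given as a relation;
  a quantity depending on \<open>l(B)\<close> is then expressed with any \<open>l\<close> such that \<open>open_box l B\<close>,
  the side lengths being determined by the set \<open>B\<close>.
\<close>

definition open_box :: "real^'n::{finite,linorder} \<Rightarrow> (real^'n::{finite,linorder}) set \<Rightarrow> bool" where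
  "open_box l B \<longleftrightarrow> decreasing_vec l \<and> (\<forall>i. 0 < l $ i) \<and>
     (\<exists>a f. orthogonal_transformation f \<and> B = (\<lambda>x. a + f x) ` box 0 l)"

definition Delta :: "(real^'n::{finite,linorder}) set" where
  "Delta = {\<delta>. (\<forall>i. 0 < \<delta> $ i \<and> \<delta> $ i < 1) \<and> decreasing_vec \<delta>}"

definition vec_powr :: "real^'n \<Rightarrow> real^'n \<Rightarrow> real" where
  "vec_powr v \<alpha> = (\<Prod>i\<in>UNIV. v $ i powr \<alpha> $ i)"

text \<open>The least cardinality of a finite cover exists when \<open>F\<close> is bounded and \<open>\<delta>\<close> is positive;
  it is 0 for the empty set.\<close>

definition box_number :: "(real^'n::{finite,linorder}) set \<Rightarrow> real^'n::{finite,linorder} \<Rightarrow> nat" where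
  "box_number F \<delta> = (LEAST k. \<exists>\<B>. finite \<B> \<and> card \<B> = k \<and> F \<subseteq> \<Union>\<B> \<and>
     (\<forall>B\<in>\<B>. \<exists>l. open_box l B \<and> (\<forall>i. l $ i \<le> \<delta> $ i)))"

definition cube_number :: "real \<Rightarrow> (real^'n::{finite,linorder}) set \<Rightarrow> nat" where
  "cube_number r E = box_number E (\<chi> i. r)"

definition Delta_to_0 :: "(real^'n::{finite,linorder}) filter" where
  "Delta_to_0 = inf (filtercomap first_coord (at_right 0)) (principal Delta)"

definition lower_box_print :: "(real^'n::{finite,linorder}) set \<Rightarrow> (real^'n::{finite,linorder}) set" where
  "lower_box_print F = {\<alpha>. (\<forall>i. 0 \<le> \<alpha> $ i) \<and>
     0 < Liminf Delta_to_0 (\<lambda>\<delta>. ereal (real (box_number F \<delta>) * vec_powr \<delta> \<alpha>))}"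

text \<open>The covers are families indexed by a set \<open>J\<close> of naturals, hence finite or countable.\<close>

definition print_premeasure ::
  "real^'n::{finite,linorder} \<Rightarrow> real \<Rightarrow> (real^'n::{finite,linorder}) set \<Rightarrow> ennreal" where
  "print_premeasure \<alpha> \<eta> E =
     Inf {(\<Sum>\<^sub>\<infinity>j\<in>J. ennreal (vec_powr (l j) \<alpha>)) | (J :: nat set) B l.
            (\<forall>j\<in>J. open_box (l j) (B j) \<and> diameter (B j) \<le> \<eta>) \<and> E \<subseteq> (\<Union>j\<in>J. B j)}"

definition print_measure :: "real^'n::{finite,linorder} \<Rightarrow> (real^'n::{finite,linorder}) set \<Rightarrow> ennreal" where
  "print_measure \<alpha> E = Lim (at_right 0) (\<lambda>\<eta>. print_premeasure \<alpha> \<eta> E)"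

definition hausdorff_print :: "(real^'n::{finite,linorder}) set \<Rightarrow> (real^'n::{finite,linorder}) set" where
  "hausdorff_print E = {\<alpha>. (\<forall>i. 0 \<le> \<alpha> $ i) \<and> 0 < print_measure \<alpha> E}"

end

theory Submission
  imports Defs
begin

text \<open>
  The inclusion of the Hausdorff print in the lower box print holds for every bounded set: a cover
  of \<open>F\<close> by \<open>N(F;\<delta>)\<close> boxes of sides at most \<open>\<delta>\<close> is one of the covers over which
  \<open>\<mu>\<^sup>\<alpha>\<^sub>\<eta>(F)\<close> is an infimum, and each of its boxes contributes at most \<open>\<delta>\<^sup>\<alpha>\<close>, so
  \<open>\<mu>\<^sup>\<alpha>\<^sub>\<eta>(F) \<le> N(F;\<delta>)\<delta>\<^sup>\<alpha>\<close> once \<open>\<delta>\<^sub>1\<close> is small compared with \<open>\<eta>\<close>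
  (\<open>print_premeasure_le_box_number\<close>).

  The converse is a mass distribution argument in which the proportions
  \<open>M\<^bsub>r\<^esub>(F \<inter> B) / M\<^bsub>r\<^esub>(F)\<close> play the part of the mass of \<open>B\<close>. By compactness only
  finite covers matter (\<open>print_premeasure_ge_if_finite_covers_ge\<close>), and for these the
  subadditivity of \<open>M\<^sub>r\<close> replaces the additivity of a measure
  (\<open>sum_covering_proportions_ge_1\<close>). If \<open>B\<^sub>1,\<dots>,B\<^sub>m\<close> are small boxes covering \<open>F\<close>, the proportions add up to at least
  1 at every scale \<open>r\<^sub>j\<close>, while the \<open>k\<close>-th of them is asymptotically at most
  \<open>C / N(F;l(B\<^sub>k))\<close>, by the hypothesis applied with \<open>\<delta> = l(B\<^sub>k)\<close>. If \<open>\<alpha>\<close> lies in the lower box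
  print, then \<open>N(F;\<delta>)\<delta>\<^sup>\<alpha> \<ge> c > 0\<close> for all small \<open>\<delta>\<close>, so this is at most
  \<open>(C/c) r\<^sup>\<alpha>(B\<^sub>k)\<close>, and hence \<open>\<Sum>\<^sub>k r\<^sup>\<alpha>(B\<^sub>k) \<ge> c/C\<close>. It matters here that the lower limit runs over
  all of \<open>\<Delta>\<^sub>n\<close>, since the shapes \<open>l(B\<^sub>k)\<close> are arbitrary.
\<close>

section \<open>Open boxes\<close>

lemma decreasing_vec_le_first:
  assumes "decreasing_vec v"
  shows "v $ i \<le> first_coord v"
  using assms unfolding decreasing_vec_def first_coord_def by simp

lemma open_box_pos: "open_box l B \<Longrightarrow> 0 < l $ i"
  unfolding open_box_def by simp

lemma open_open_box:
  assumes "open_box l B"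
  shows "open B"
proof -
  obtain a f where f: "orthogonal_transformation f" and B: "B = (\<lambda>x. a + f x) ` box 0 l"
    using assms unfolding open_box_def by blast
  have "open (f ` box 0 l)"
    using f by (intro open_surjective_linear_image orthogonal_transformation_surj
        orthogonal_transformation_linear open_box)
  then have "open ((+) a ` (f ` box 0 l))" by (rule open_translation)
  then show ?thesis by (simp add: B image_image)
qed

lemma diameter_open_box:
  assumes "open_box l B"
  shows "diameter B = norm l"
proof -
  obtain a f where f: "orthogonal_transformation f" and B: "B = (\<lambda>x. a + f x) ` box 0 l"
    using assms unfolding open_box_def by blast
  have pos: "\<And>i. 0 < l $ i" using assms by (rule open_box_pos)
  have isometry: "dist (a + f x) (a + f y) = dist x y" for x y
    using f by (simp add: orthogonal_transformation_isometry)
  have "(case_prod dist) ` (B \<times> B) = (case_prod dist) ` (box 0 l \<times> box 0 l)"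
  proof -
    have "B \<times> B = map_prod (\<lambda>x. a + f x) (\<lambda>x. a + f x) ` (box 0 l \<times> box 0 l)"
      unfolding B by (simp add: map_prod_surj_on)
    then show ?thesis by (simp add: image_image case_prod_beta isometry del: dist_add_cancel)
  qed
  moreover have ne: "box 0 l \<noteq> {}"
    using pos by (auto simp: box_ne_empty Basis_vec_def inner_axis)
  moreover from this have "B \<noteq> {}" by (simp add: B)
  ultimately have "diameter B = diameter (box 0 l)" by (simp add: diameter_def)
  also have "\<dots> = diameter (cbox 0 l)"
    using diameter_closure[OF bounded_box, of 0 l] closure_box[OF ne] by simp
  also have "\<dots> = norm l"
    using pos by (subst diameter_cbox) (auto simp: Basis_vec_def inner_axis less_imp_le)
  finally show ?thesis .
qed

text \<open>
  A box of small diameter has an admissible shape of its own, so that statements about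
  \<open>\<delta> \<in> \<Delta>\<^sub>n\<close> may be applied to its side lengths.
\<close>

lemma open_box_sides_in_Delta:
  assumes "open_box l B" "diameter B \<le> \<eta>" "\<eta> < 1"
  shows "l \<in> Delta" "first_coord l \<le> \<eta>"
proof -
  have bound: "l $ i \<le> \<eta>" for i
    using component_le_norm_cart[of l i] diameter_open_box[OF assms(1)] assms(2) by simp
  show "first_coord l \<le> \<eta>" using bound by (simp add: first_coord_def)
  show "l \<in> Delta"
    using assms bound open_box_pos[OF assms(1)]
    by (auto simp: Delta_def open_box_def intro: le_less_trans)
qed

lemma open_box_centred_at:
  assumes "decreasing_vec \<delta>" "\<And>i. 0 < \<delta> $ i"
  shows "open_box \<delta> ((+) (x - (1/2) *\<^sub>R \<delta>) ` box 0 \<delta>)" (is "open_box \<delta> ?B")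
    and "x \<in> (+) (x - (1/2) *\<^sub>R \<delta>) ` box 0 \<delta>"
proof -
  have "orthogonal_transformation (id :: real^'n \<Rightarrow> _)"
    by (simp add: orthogonal_transformation_id id_def)
  then show "open_box \<delta> ?B"
    using assms unfolding open_box_def
    by (intro conjI allI exI[of _ "x - (1/2) *\<^sub>R \<delta>"] exI[of _ id]) simp_all
  have "(1/2) *\<^sub>R \<delta> \<in> box 0 \<delta>"
    using assms(2) by (auto simp: mem_box Basis_vec_def inner_axis)
  then show "x \<in> ?B" by (rule rev_image_eqI) simp
qed

lemma vec_powr_pos:
  assumes "\<And>i. 0 < v $ i"
  shows "0 < vec_powr v \<alpha>"
  using assms unfolding vec_powr_def by (intro prod_pos) (simp add: less_imp_neq[symmetric])

lemma vec_powr_mono: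
  assumes "\<And>i. 0 \<le> \<alpha> $ i" "\<And>i. 0 < v $ i" "\<And>i. v $ i \<le> w $ i"
  shows "vec_powr v \<alpha> \<le> vec_powr w \<alpha>"
  using assms unfolding vec_powr_def by (intro prod_mono) (simp add: powr_mono2 less_imp_le)

section \<open>Covering numbers\<close>

definition box_cover ::
  "(real^'n::{finite,linorder}) set \<Rightarrow> real^'n::{finite,linorder} \<Rightarrow>
    (real^'n::{finite,linorder}) set set \<Rightarrow> bool" where
  "box_cover E \<delta> \<B> \<longleftrightarrow> finite \<B> \<and> E \<subseteq> \<Union>\<B> \<and>
     (\<forall>B\<in>\<B>. \<exists>l. open_box l B \<and> (\<forall>i. l $ i \<le> \<delta> $ i))"

lemma box_number_eq: "box_number E \<delta> = (LEAST k. \<exists>\<B>. box_cover E \<delta> \<B> \<and> card \<B> = k)"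
  unfolding box_number_def box_cover_def by (rule arg_cong[where f = Least]) (auto simp: fun_eq_iff)

lemma box_number_le_card: "box_cover E \<delta> \<B> \<Longrightarrow> box_number E \<delta> \<le> card \<B>"
  unfolding box_number_eq by (intro Least_le) blast

text \<open>
  The least number is attained: translates of the box with side lengths \<open>\<delta>\<close> centred at the points
  of the compact closure of \<open>E\<close> have a finite subcover.
\<close>

lemma optimal_box_cover:
  assumes "bounded E" "decreasing_vec \<delta>" "\<And>i. 0 < \<delta> $ i"
  obtains \<B> where "box_cover E \<delta> \<B>" "card \<B> = box_number E \<delta>"
proof -
  define b where "b x = (+) (x - (1/2) *\<^sub>R \<delta>) ` box 0 \<delta>" for x
  have b: "open_box \<delta> (b x)" "x \<in> b x" for x
    unfolding b_def by (rule open_box_centred_at[OF assms(2,3)])+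
  have "compact (closure E)" using assms(1) by (simp add: compact_closure)
  moreover have "\<And>x. x \<in> closure E \<Longrightarrow> open (b x)" using b(1) open_open_box by blast
  moreover have "closure E \<subseteq> (\<Union>x\<in>closure E. b x)" using b(2) by blast
  ultimately obtain D where "finite D" "closure E \<subseteq> (\<Union>x\<in>D. b x)"
    by (rule compactE_image)
  then have "box_cover E \<delta> (b ` D)"
    unfolding box_cover_def using b(1) closure_subset[of E] by blast
  then have "\<exists>\<B>. box_cover E \<delta> \<B> \<and> card \<B> = card (b ` D)" by blast
  from LeastI[of "\<lambda>k. \<exists>\<B>. box_cover E \<delta> \<B> \<and> card \<B> = k", OF this] that
  show thesis unfolding box_number_eq by blast
qed

lemma box_number_pos:
  assumes "bounded E" "E \<noteq> {}" "decreasing_vec \<delta>" "\<And>i. 0 < \<delta> $ i"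
  shows "0 < box_number E \<delta>"
proof -
  obtain \<B> where \<B>: "box_cover E \<delta> \<B>" "card \<B> = box_number E \<delta>"
    using optimal_box_cover[OF assms(1,3,4)] by blast
  then have "\<B> \<noteq> {}" "finite \<B>" using assms(2) by (auto simp: box_cover_def)
  then show ?thesis using \<B>(2) card_gt_0_iff by metis
qed

lemma box_number_subadditive:
  assumes "bounded E" "decreasing_vec \<delta>" "\<And>i. 0 < \<delta> $ i"
    and "finite J" "E \<subseteq> (\<Union>j\<in>J. B j)"
  shows "box_number E \<delta> \<le> (\<Sum>j\<in>J. box_number (E \<inter> B j) \<delta>)"
proof -
  have "\<exists>\<B>. box_cover (E \<inter> B j) \<delta> \<B> \<and> card \<B> = box_number (E \<inter> B j) \<delta>" for j
    by (rule optimal_box_cover[of "E \<inter> B j" \<delta>]) (use assms(1-3) in \<open>auto intro: bounded_Int\<close>)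
  then obtain \<B> where \<B>: "\<And>j. box_cover (E \<inter> B j) \<delta> (\<B> j)"
      "\<And>j. card (\<B> j) = box_number (E \<inter> B j) \<delta>"
    by metis
  have "E \<subseteq> \<Union>(\<Union>j\<in>J. \<B> j)"
  proof
    fix x assume "x \<in> E"
    then obtain j where "j \<in> J" "x \<in> E \<inter> B j" using assms(5) by blast
    then show "x \<in> \<Union>(\<Union>j\<in>J. \<B> j)" using \<B>(1)[of j] unfolding box_cover_def by blast
  qed
  then have "box_cover E \<delta> (\<Union>j\<in>J. \<B> j)"
    using \<B>(1) assms(4) unfolding box_cover_def by auto
  then have "box_number E \<delta> \<le> card (\<Union>j\<in>J. \<B> j)" by (rule box_number_le_card)
  also have "\<dots> \<le> (\<Sum>j\<in>J. card (\<B> j))" using assms(4) by (rule card_UN_le)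
  finally show ?thesis by (simp add: \<B>(2))
qed

section \<open>The lower box print and the Hausdorff print\<close>

lemma eventually_Delta_to_0:
  "eventually P Delta_to_0 \<longleftrightarrow> (\<exists>\<epsilon>>0. \<forall>\<delta>\<in>Delta. first_coord \<delta> < \<epsilon> \<longrightarrow> P \<delta>)"
    (is "?lhs \<longleftrightarrow> ?rhs")
proof
  assume ?lhs
  then obtain Q where Q: "eventually Q (at_right (0::real))"
      "\<And>\<delta>. Q (first_coord \<delta>) \<Longrightarrow> \<delta> \<in> Delta \<Longrightarrow> P \<delta>"
    unfolding Delta_to_0_def eventually_inf_principal eventually_filtercomap by blast
  then obtain \<epsilon> where "\<epsilon> > 0" "\<And>y. 0 < y \<Longrightarrow> y < \<epsilon> \<Longrightarrow> Q y"
    unfolding eventually_at_right_field by blast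
  then show ?rhs using Q(2) by (auto simp: Delta_def first_coord_def)
next
  assume ?rhs
  then obtain \<epsilon> where "\<epsilon> > 0" "\<And>\<delta>. \<delta> \<in> Delta \<Longrightarrow> first_coord \<delta> < \<epsilon> \<Longrightarrow> P \<delta>" by blast
  then show ?lhs
    unfolding Delta_to_0_def eventually_inf_principal eventually_filtercomap
    by (intro exI[of _ "\<lambda>y. y < \<epsilon>"]) (auto simp: eventually_at_right_field)
qed

lemma mem_lower_box_print_iff:
  "\<alpha> \<in> lower_box_print F \<longleftrightarrow> (\<forall>i. 0 \<le> \<alpha> $ i) \<and>
     (\<exists>c>0. \<exists>\<epsilon>>0. \<forall>\<delta>\<in>Delta. first_coord \<delta> < \<epsilon> \<longrightarrow> c \<le> real (box_number F \<delta>) * vec_powr \<delta> \<alpha>)"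
proof -
  define X where "X \<delta> = real (box_number F \<delta>) * vec_powr \<delta> \<alpha>" for \<delta>
  have "0 < Liminf Delta_to_0 (\<lambda>\<delta>. ereal (X \<delta>)) \<longleftrightarrow>
      (\<exists>c>0. eventually (\<lambda>\<delta>. c \<le> X \<delta>) Delta_to_0)"
  proof
    assume "0 < Liminf Delta_to_0 (\<lambda>\<delta>. ereal (X \<delta>))"
    then obtain c where c: "0 < ereal c" "ereal c < Liminf Delta_to_0 (\<lambda>\<delta>. ereal (X \<delta>))"
      using ereal_dense2 by blast
    from less_LiminfD[OF c(2)] have "eventually (\<lambda>\<delta>. c \<le> X \<delta>) Delta_to_0"
      by eventually_elim simp
    then show "\<exists>c>0. eventually (\<lambda>\<delta>. c \<le> X \<delta>) Delta_to_0" using c(1) by auto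
  next
    assume "\<exists>c>0. eventually (\<lambda>\<delta>. c \<le> X \<delta>) Delta_to_0"
    then obtain c where c: "c > 0" "eventually (\<lambda>\<delta>. c \<le> X \<delta>) Delta_to_0" by blast
    from c(2) have "eventually (\<lambda>\<delta>. ereal c \<le> ereal (X \<delta>)) Delta_to_0"
      by simp
    then have "ereal c \<le> Liminf Delta_to_0 (\<lambda>\<delta>. ereal (X \<delta>))" by (rule Liminf_bounded)
    with c(1) show "0 < Liminf Delta_to_0 (\<lambda>\<delta>. ereal (X \<delta>))"
      by (meson ereal_less(2) less_le_trans)
  qed
  then show ?thesis by (simp add: lower_box_print_def eventually_Delta_to_0 X_def)
qed

lemma print_premeasure_antimono:
  assumes "\<eta> \<le> \<eta>'"
  shows "print_premeasure \<alpha> \<eta>' E \<le> print_premeasure \<alpha> \<eta> E"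
  unfolding print_premeasure_def using assms
  by (intro Inf_superset_mono) (blast intro: order_trans)

lemma print_measure_eq_SUP: "print_measure \<alpha> E = (SUP \<eta>\<in>{0<..}. print_premeasure \<alpha> \<eta> E)"
proof -
  have "((\<lambda>\<eta>. print_premeasure \<alpha> \<eta> E) \<longlongrightarrow> (SUP \<eta>\<in>{0<..}. print_premeasure \<alpha> \<eta> E)) (at_right 0)"
  proof (rule order_tendstoI)
    fix a assume "a < (SUP \<eta>\<in>{0<..}. print_premeasure \<alpha> \<eta> E)"
    then obtain \<eta>' where \<eta>': "\<eta>' > 0" "a < print_premeasure \<alpha> \<eta>' E"
      by (auto simp: less_SUP_iff)
    then show "\<forall>\<^sub>F \<eta> in at_right 0. a < print_premeasure \<alpha> \<eta> E"
      unfolding eventually_at_right_field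
      by (intro exI[of _ \<eta>']) (auto elim!: less_le_trans intro: print_premeasure_antimono)
  next
    fix a assume a: "(SUP \<eta>\<in>{0<..}. print_premeasure \<alpha> \<eta> E) < a"
    have "print_premeasure \<alpha> \<eta> E < a" if "\<eta> > 0" for \<eta>
      using that by (intro le_less_trans[OF SUP_upper a]) simp
    then show "\<forall>\<^sub>F \<eta> in at_right 0. print_premeasure \<alpha> \<eta> E < a"
      unfolding eventually_at_right_field by (intro exI[of _ 1]) auto
  qed
  then show ?thesis unfolding print_measure_def by (intro tendsto_Lim) auto
qed

lemma print_measure_pos_iff:
  "0 < print_measure \<alpha> E \<longleftrightarrow> (\<exists>\<eta>>0. 0 < print_premeasure \<alpha> \<eta> E)"
  unfolding print_measure_eq_SUP by (auto simp: less_SUP_iff)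

section \<open>The Hausdorff print lies in the lower box print\<close>

text \<open>
  The factor \<open>n\<close> on \<open>\<delta>\<^sub>1\<close> is a crude bound for the diameter of a box, whose sides are all at most
  \<open>\<delta>\<^sub>1\<close>.
\<close>

lemma print_premeasure_le_box_number:
  fixes E :: "(real^'n::{finite,linorder}) set"
  assumes "bounded E" "\<delta> \<in> Delta" "\<And>i. 0 \<le> \<alpha> $ i"
    and "real CARD('n) * first_coord \<delta> \<le> \<eta>"
  shows "print_premeasure \<alpha> \<eta> E \<le> ennreal (real (box_number E \<delta>) * vec_powr \<delta> \<alpha>)"
proof -
  have \<delta>: "decreasing_vec \<delta>" "\<And>i. 0 < \<delta> $ i" using assms(2) by (auto simp: Delta_def)
  obtain \<B> where \<B>: "box_cover E \<delta> \<B>" "card \<B> = box_number E \<delta>"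
    using optimal_box_cover[OF assms(1) \<delta>] by blast
  define N where "N = box_number E \<delta>"
  obtain B where B: "bij_betw B {0..<N} \<B>"
    using ex_bij_betw_nat_finite[of \<B>] \<B> by (auto simp: box_cover_def N_def)
  have "\<exists>l. open_box l (B j) \<and> (\<forall>i. l $ i \<le> \<delta> $ i)" if "j < N" for j
    using bij_betwE[OF B] \<B>(1) that by (auto simp: box_cover_def)
  then obtain l where l: "\<And>j. j < N \<Longrightarrow> open_box (l j) (B j)"
      "\<And>j i. j < N \<Longrightarrow> l j $ i \<le> \<delta> $ i"
    by metis
  have small: "diameter (B j) \<le> \<eta>" if "j < N" for j
  proof -
    have "diameter (B j) = norm (l j)" using l(1)[OF that] by (rule diameter_open_box)
    also have "\<dots> \<le> (\<Sum>i\<in>UNIV. \<bar>l j $ i\<bar>)" by (rule norm_le_l1_cart)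
    also have "\<dots> \<le> (\<Sum>i\<in>(UNIV::'n set). first_coord \<delta>)"
      using open_box_pos[OF l(1)[OF that]] l(2)[OF that] decreasing_vec_le_first[OF \<delta>(1)]
      by (intro sum_mono) (metis abs_of_pos order_trans)
    also have "\<dots> \<le> \<eta>" using assms(4) by simp
    finally show ?thesis .
  qed
  have "E \<subseteq> (\<Union>j\<in>{0..<N}. B j)"
    using \<B>(1) bij_betw_imp_surj_on[OF B] by (simp add: box_cover_def)
  then have "print_premeasure \<alpha> \<eta> E \<le> (\<Sum>\<^sub>\<infinity>j\<in>{0..<N}. ennreal (vec_powr (l j) \<alpha>))"
    unfolding print_premeasure_def using l(1) small
    by (intro Inf_lower CollectI exI[of _ "{0..<N}"] exI[of _ B] exI[of _ l]) auto
  also have "\<dots> = (\<Sum>j\<in>{0..<N}. ennreal (vec_powr (l j) \<alpha>))" by simp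
  also have "\<dots> \<le> (\<Sum>j\<in>{0..<N}. ennreal (vec_powr \<delta> \<alpha>))"
    using assms(3) l by (intro sum_mono ennreal_leI vec_powr_mono) (auto intro: open_box_pos)
  also have "\<dots> = ennreal (real N * vec_powr \<delta> \<alpha>)"
    using vec_powr_pos[OF \<delta>(2), of \<alpha>] by (subst sum_ennreal) (auto simp: less_imp_le)
  finally show ?thesis by (simp add: N_def)
qed

lemma hausdorff_print_subset_lower_box_print:
  fixes E :: "(real^'n::{finite,linorder}) set"
  assumes "bounded E"
  shows "hausdorff_print E \<subseteq> lower_box_print E"
proof
  fix \<alpha> assume "\<alpha> \<in> hausdorff_print E"
  then obtain \<eta> where \<alpha>: "\<And>i. 0 \<le> \<alpha> $ i" and \<eta>: "\<eta> > 0" "0 < print_premeasure \<alpha> \<eta> E"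
    by (auto simp: hausdorff_print_def print_measure_pos_iff)
  from dense[OF \<eta>(2)] obtain c where c: "0 < ennreal c" "ennreal c < print_premeasure \<alpha> \<eta> E"
    by (metis ennreal_cases not_top_less)
  have "c \<le> real (box_number E \<delta>) * vec_powr \<delta> \<alpha>"
    if "\<delta> \<in> Delta" "first_coord \<delta> < \<eta> / real CARD('n)" for \<delta>
  proof -
    have "real CARD('n) * first_coord \<delta> \<le> \<eta>" using that(2) by (simp add: field_simps)
    then have "ennreal c < ennreal (real (box_number E \<delta>) * vec_powr \<delta> \<alpha>)"
      using print_premeasure_le_box_number[OF assms that(1) \<alpha>] c(2) less_le_trans by blast
    then have "\<not> real (box_number E \<delta>) * vec_powr \<delta> \<alpha> < c"
      by (meson ennreal_leI leD less_imp_le)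
    then show ?thesis by simp
  qed
  moreover have "0 < c" using c(1) by simp
  moreover have "0 < \<eta> / real CARD('n)" using \<eta>(1) by simp
  ultimately show "\<alpha> \<in> lower_box_print E" using \<alpha> unfolding mem_lower_box_print_iff by blast
qed

section \<open>A mass distribution principle for covering numbers\<close>

text \<open>
  By subadditivity of the covering number the proportions add up to at least 1 at each single
  scale \<open>r j\<close>. A finite family has a scale at which all proportions are within a prescribed error
  of their asymptotic bounds, so the bounds inherit the inequality.
\<close>

lemma sum_covering_proportions_ge_1:
  fixes F :: "(real^'n::{finite,linorder}) set"
  assumes F: "bounded F" "F \<noteq> {}"
    and r: "\<And>j. 0 < r j"
    and J: "finite J" "F \<subseteq> (\<Union>k\<in>J. B k)"
    and limit: "\<And>k. k \<in> J \<Longrightarrow>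
      limsup (\<lambda>j. ereal (real (cube_number (r j) (F \<inter> B k)) / real (cube_number (r j) F))) \<le> ereal (q k)"
  shows "1 \<le> sum q J"
proof (rule field_le_epsilon)
  fix e :: real assume "e > 0"
  \<comment> \<open>Adding 1 to the cardinality keeps the quotient meaningful for the empty family.\<close>
  define d where "d = e / (real (card J) + 1)"
  have d: "d > 0" "real (card J) * d \<le> e"
    using \<open>e > 0\<close> by (auto simp: d_def field_simps)
  define p where "p k j = real (cube_number (r j) (F \<inter> B k)) / real (cube_number (r j) F)" for k j
  have "\<forall>\<^sub>F j in sequentially. p k j < q k + d" if "k \<in> J" for k
  proof -
    have "limsup (\<lambda>j. ereal (p k j)) < ereal (q k + d)"
      using limit[OF that] d(1) unfolding p_def by (auto intro: le_less_trans)
    from Limsup_lessD[OF this] show ?thesis by simp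
  qed
  then have "\<forall>\<^sub>F j in sequentially. \<forall>k\<in>J. p k j < q k + d"
    using J(1) by (simp add: eventually_ball_finite)
  then obtain j where j: "\<And>k. k \<in> J \<Longrightarrow> p k j < q k + d"
    using eventually_happens'[OF sequentially_bot] by blast
  define \<rho> :: "real^'n::{finite,linorder}" where "\<rho> = (\<chi> i. r j)"
  have \<rho>: "decreasing_vec \<rho>" "\<And>i. 0 < \<rho> $ i"
    by (auto simp: \<rho>_def decreasing_vec_def r)
  have pos: "0 < cube_number (r j) F"
    using box_number_pos[OF F \<rho>] by (simp add: cube_number_def \<rho>_def)
  have "cube_number (r j) F \<le> (\<Sum>k\<in>J. cube_number (r j) (F \<inter> B k))"
    using box_number_subadditive[OF F(1) \<rho> J] by (simp add: cube_number_def \<rho>_def)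
  then have "real (cube_number (r j) F) \<le> (\<Sum>k\<in>J. real (cube_number (r j) (F \<inter> B k)))"
    by (metis of_nat_le_iff of_nat_sum)
  then have "1 \<le> (\<Sum>k\<in>J. p k j)"
    using pos by (simp add: p_def sum_divide_distrib[symmetric])
  also have "\<dots> \<le> (\<Sum>k\<in>J. q k + d)"
    using j by (intro sum_mono less_imp_le) auto
  also have "\<dots> \<le> sum q J + e" using d(2) by (simp add: sum.distrib)
  finally show "1 \<le> sum q J + e" .
qed

text \<open>
  Since boxes are open and \<open>F\<close> is compact, a bound from below on the finite covers of \<open>F\<close> passes
  to the countable ones.
\<close>

lemma print_premeasure_ge_if_finite_covers_ge:
  assumes "compact F"
    and finite_covers: "\<And>(J :: nat set) B l. finite J \<Longrightarrow>
      (\<And>j. j \<in> J \<Longrightarrow> open_box (l j) (B j) \<and> diameter (B j) \<le> \<eta>) \<Longrightarrow>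
      F \<subseteq> (\<Union>j\<in>J. B j) \<Longrightarrow> c \<le> (\<Sum>j\<in>J. vec_powr (l j) \<alpha>)"
  shows "ennreal c \<le> print_premeasure \<alpha> \<eta> F"
  unfolding print_premeasure_def
proof (rule Inf_greatest, clarify)
  fix J :: "nat set" and B l
  assume boxes: "\<forall>j\<in>J. open_box (l j) (B j) \<and> diameter (B j) \<le> \<eta>"
    and cover: "F \<subseteq> (\<Union>j\<in>J. B j)"
  have "\<And>j. j \<in> J \<Longrightarrow> open (B j)" using boxes open_open_box by blast
  from compactE_image[OF assms(1) this cover]
  obtain D where D: "D \<subseteq> J" "finite D" "F \<subseteq> (\<Union>j\<in>D. B j)" by metis
  have "c \<le> (\<Sum>j\<in>D. vec_powr (l j) \<alpha>)"
    using D boxes by (intro finite_covers[of D l B]) auto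
  then have "ennreal c \<le> ennreal (\<Sum>j\<in>D. vec_powr (l j) \<alpha>)" by (rule ennreal_leI)
  also have "\<dots> = (\<Sum>j\<in>D. ennreal (vec_powr (l j) \<alpha>))"
    by (subst sum_ennreal) (auto simp: vec_powr_def intro: prod_nonneg)
  also have "\<dots> = (\<Sum>\<^sub>\<infinity>j\<in>D. ennreal (vec_powr (l j) \<alpha>))" using D(2) by simp
  also have "\<dots> \<le> (\<Sum>\<^sub>\<infinity>j\<in>J. ennreal (vec_powr (l j) \<alpha>))"
    using D(1) by (intro infsum_mono_neutral nonneg_summable_on_complete) auto
  finally show "ennreal c \<le> (\<Sum>\<^sub>\<infinity>j\<in>J. ennreal (vec_powr (l j) \<alpha>))" .
qed

theorem proposition5p2:
  fixes F :: "(real^'n::{finite,linorder}) set"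
    and C \<eta>\<^sub>0 :: real
    and r :: "nat \<Rightarrow> real"
  assumes "F \<noteq> {}" and "compact F"
    and "1 \<le> C" and "0 < \<eta>\<^sub>0" and "\<eta>\<^sub>0 < 1"
    and "\<And>j. 0 < r j \<and> r j < 1" and "decseq r" and "r \<longlonglongrightarrow> 0"
    and "\<And>\<delta> l B. \<delta> \<in> Delta \<Longrightarrow> first_coord \<delta> < \<eta>\<^sub>0 \<Longrightarrow> open_box l B \<Longrightarrow> (\<forall>i. l $ i \<le> \<delta> $ i) \<Longrightarrow>
           limsup (\<lambda>j. ereal (real (cube_number (r j) (F \<inter> B)) / real (cube_number (r j) F)))
             \<le> ereal (C / real (box_number F \<delta>))"
  shows "hausdorff_print F = lower_box_print F"
proof
  have bounded: "bounded F" using assms(2) by (rule compact_imp_bounded)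
  then show "hausdorff_print F \<subseteq> lower_box_print F" by (rule hausdorff_print_subset_lower_box_print)
  show "lower_box_print F \<subseteq> hausdorff_print F"
  proof
    fix \<alpha> assume "\<alpha> \<in> lower_box_print F"
    then obtain c \<epsilon> where \<alpha>: "\<And>i. 0 \<le> \<alpha> $ i" and "c > 0" "\<epsilon> > 0"
      and c: "\<And>\<delta>. \<delta> \<in> Delta \<Longrightarrow> first_coord \<delta> < \<epsilon> \<Longrightarrow>
                c \<le> real (box_number F \<delta>) * vec_powr \<delta> \<alpha>"
      unfolding mem_lower_box_print_iff by blast
    \<comment> \<open>The halving gives \<open>l\<^sub>1(B) \<le> diam B \<le> \<eta>\<close> strictly below both thresholds.\<close>
    define \<eta> where "\<eta> = min \<eta>\<^sub>0 \<epsilon> / 2"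
    have \<eta>: "0 < \<eta>" "\<eta> < \<eta>\<^sub>0" "\<eta> < \<epsilon>" using \<open>\<epsilon> > 0\<close> assms(4) by (auto simp: \<eta>_def)
    have "ennreal (c / C) \<le> print_premeasure \<alpha> \<eta> F"
    proof (rule print_premeasure_ge_if_finite_covers_ge[OF assms(2)])
      fix J :: "nat set" and B l
      assume J: "finite J" "F \<subseteq> (\<Union>j\<in>J. B j)"
        and box: "\<And>j. j \<in> J \<Longrightarrow> open_box (l j) (B j) \<and> diameter (B j) \<le> \<eta>"
      have "1 \<le> (\<Sum>k\<in>J. C / c * vec_powr (l k) \<alpha>)"
      proof (rule sum_covering_proportions_ge_1[OF bounded assms(1) _ J])
        fix k assume "k \<in> J"
        note B = box[OF this, THEN conjunct1]
        have l: "l k \<in> Delta" "first_coord (l k) \<le> \<eta>"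
          using open_box_sides_in_Delta[of "l k" "B k" \<eta>] box[OF \<open>k \<in> J\<close>] \<eta> assms(5) by auto
        have "decreasing_vec (l k)" "\<And>i. 0 < l k $ i" using l(1) by (auto simp: Delta_def)
        then have "0 < box_number F (l k)" by (intro box_number_pos bounded assms(1))
        moreover have "c \<le> real (box_number F (l k)) * vec_powr (l k) \<alpha>"
          using c[OF l(1)] l(2) \<eta>(3) by simp
        ultimately have "C / real (box_number F (l k)) \<le> C / c * vec_powr (l k) \<alpha>"
          using \<open>c > 0\<close> assms(3) by (simp add: field_simps)
        moreover have "limsup (\<lambda>j. ereal (real (cube_number (r j) (F \<inter> B k)) / real (cube_number (r j) F)))
            \<le> ereal (C / real (box_number F (l k)))"
          using assms(9)[OF l(1) _ B] l(2) \<eta>(2) by simp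
        ultimately show "limsup (\<lambda>j. ereal (real (cube_number (r j) (F \<inter> B k)) / real (cube_number (r j) F)))
            \<le> ereal (C / c * vec_powr (l k) \<alpha>)"
          by (meson ereal_less_eq(3) order_trans)
      qed (use assms(6) in blast)
      then have "1 \<le> C / c * (\<Sum>k\<in>J. vec_powr (l k) \<alpha>)" by (simp add: sum_distrib_left)
      then show "c / C \<le> (\<Sum>k\<in>J. vec_powr (l k) \<alpha>)"
        using \<open>c > 0\<close> assms(3) by (simp add: field_simps)
    qed
    moreover have "0 < ennreal (c / C)" using \<open>c > 0\<close> assms(3) by simp
    ultimately have "0 < print_premeasure \<alpha> \<eta> F" by (rule less_le_trans[rotated])
    then show "\<alpha> \<in> hausdorff_print F"
      using \<alpha> \<eta>(1) by (auto simp: hausdorff_print_def print_measure_pos_iff)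
  qed
qed

end
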